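(* For every $\alpha>0$, the discrete Tikhonov functional $J_{h,\alpha}:\mathbb{R}^{N_0}\to\mathbb{R}$, \[ J_{h,\alpha}(\mathbf v)=(B\mathbf v-\mu_W^\delta)^\top \mathbf W(B\mathbf v-\mu_W^\delta)+\alpha\,\mathbf v^\top S\mathbf v , \] admits a unique minimizer $\mathbf v_h^\alpha\in\mathbb{R}^{N_0}$. Moreover, $\mathbf v_h^\alpha$ is the unique solution of the symmetric positive definite linear system \[ (B^\top \mathbf W B+\alpha S)\,\mathbf v_h^\alpha=B^\top\mathbf W\,\mu_W^\delta . \]
   Context: Let $d\ge1$, $s\in(0,1)$, $\Omega\subset\mathbb{R}^d$ a bounded Lipschitz polygonal/polyhedral domain, $\Omega_e=\mathbb{R}^d\setminus\overline\Omega$, and $W\subset\subset\Omega_e$ a nonempty bounded open set with $\operatorname{dist}(W,\Omega)=d_0>0$. Let $\Omega_R=(-R,R)^d\supset\Omega\cup W$, $c_{d,s}>0$ the normalization constant of the integral fractional Laplacian $(-\Delta)^s u(x)=c_{d,s}\,\mathrm{P.V.}\int_{\mathbb{R}^d}\frac{u(x)-u(y)}{|x-y|^{d+2s}}dy$. Interior space: $\mathcal T_h$ is a quasi-uniform mesh of $\Omega_R$ of mesh size $h$ fitted to $\Omega$ ($\partial\Omega$ is a union of faces), $V_h\subset H^1(\Omega_R)$ the continuous piecewise polynomial finite element space of degree $p\ge1$, $V_{h,0}=\{v_h\in V_h: v_h=0\text{ on }\Omega_R\setminus\Omega\}$ with nodal basis $\{\varphi_i\}_{i=1}^{N_0}$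 (functions extended by zero to $\mathbb{R}^d$). Observation space: $\mathcal T_h^W$ is a shape-regular mesh of $W$, $S_h^W\subset C(\overline W)$ the continuous piecewise polynomial finite element space on it, with nodal basis $\{\vartheta_k\}_{k=1}^{N_W}$ and nodes $\{x_k\}_{k=1}^{N_W}\subset\overline W$. $\mathbf W\in\mathbb{R}^{N_W\times N_W}$, $\mathbf W_{ij}=\int_W\vartheta_i\vartheta_j\,dx$. The data space is $Y=\mathbb{R}^{N_W}$ with $\|y\|_Y^2=y^\top\mathbf W y$. Matrices: $B\in\mathbb{R}^{N_W\times N_0}$, $B_{ki}=-c_{d,s}\int_\Omega\frac{\varphi_i(y)}{|x_k-y|^{d+2s}}dy$. With \[ a_R(u,v)=\frac{c_{d,s}}{2}\iint_{\Omega_R\times\Omega_R}\frac{(u(x)-u(y))(v(x)-v(y))}{|x-y|^{d+2s}}dx\,dy+c_{d,s}\int_{\Omega_R}u(x)v(x)\Big(\int_{\mathbb{R}^d\setminus\Omega_R}\frac{dy}{|x-y|^{d+2s}}\Big)dx, \] set $(A_0)_{ij}=a_R(\varphi_i,\varphi_j)$, $(M_0)_{ij}=(\varphi_i,\varphi_j)_{L^2(\Omega_R)}$, $S=A_0+M_0$. Data: $\mu_W^\delta\in Y$ is the given noisy preprocessed data vector (with entries $g^\delta(x_k)-(\mathcal L_{h,R}u_{h,f})_k$, where $g^\delta$ is a noisy exterior measurement on $W$, $u_{h,f}\in V_h$ is the nodal interpolant on $\Omega_R$ of the zero extension of a fixed exterior datum $f\in C_c^\infty(W)$, and $(\mathcal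 L_{h,R}v)_k=c_{d,s}\,\mathrm{P.V.}\int_{\Omega_R}\frac{v(x_k)-v(y)}{|x_k-y|^{d+2s}}dy$). *)

theory Defs
  imports "HOL-Analysis.Analysis" "Jordan_Normal_Form.Matrix"
begin

(* "$" is reserved for the components of points of real^'d and the bullet for the scalar product
   of the coefficient vectors of Jordan_Normal_Form. *)
no_notation vec_index (infixl "$" 100)
no_notation inner (infix "\<bullet>" 70)

section \<open>Polyhedral Lipschitz domains\<close>

text \<open>Near each boundary point, \<open>\<Omega>\<close> is the strict epigraph, in some unit direction \<open>e\<close>, of a
  Lipschitz function \<open>g\<close> on the hyperplane orthogonal to \<open>e\<close>.\<close>

definition lipschitz_boundary :: "(real^'d) set \<Rightarrow> bool" where
  "lipschitz_boundary \<Omega> \<longleftrightarrow>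
     (\<forall>x0 \<in> frontier \<Omega>. \<exists>r > 0. \<exists>e. norm e = 1 \<and>
        (\<exists>g :: real^'d \<Rightarrow> real. \<exists>L. L-lipschitz_on {y. inner y e = 0} g \<and>
           \<Omega> \<inter> ball x0 r = {x \<in> ball x0 r. g (x - inner x e *\<^sub>R e) < inner x e}))"

definition polyhedral_boundary :: "(real^'d) set \<Rightarrow> bool" where
  "polyhedral_boundary \<Omega> \<longleftrightarrow>
     (\<exists>\<F>. finite \<F> \<and> (\<forall>P \<in> \<F>. polytope P \<and> aff_dim P = int CARD('d) - 1) \<and>
          frontier \<Omega> = \<Union>\<F>)"

definition lipschitz_polyhedral_domain :: "(real^'d) set \<Rightarrow> bool" where
  "lipschitz_polyhedral_domain \<Omega> \<longleftrightarrow>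
     open \<Omega> \<and> connected \<Omega> \<and> \<Omega> \<noteq> {} \<and> bounded \<Omega> \<and>
     lipschitz_boundary \<Omega> \<and> polyhedral_boundary \<Omega>"

definition cube :: "real \<Rightarrow> (real^'d) set" where
  "cube R = box (\<chi> i. - R) (\<chi> i. R)"


section \<open>Smooth functions with compact support\<close>

text \<open>A function is \<open>C\<^sup>\<infinity>\<close> iff all its iterated directional derivatives exist and are
  (Frechet) differentiable everywhere.\<close>

definition smooth :: "(real^'d \<Rightarrow> real) \<Rightarrow> bool" where
  "smooth f \<longleftrightarrow>
     (\<forall>vs x. foldr (\<lambda>v g y. frechet_derivative g (at y) v) vs f differentiable (at x))"

text \<open>Elements of \<open>C\<^sub>c\<^sup>\<infinity>(W)\<close>, identified with their zero extensions to the whole space.\<close>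

definition test_function :: "(real^'d) set \<Rightarrow> (real^'d \<Rightarrow> real) \<Rightarrow> bool" where
  "test_function W f \<longleftrightarrow>
     smooth f \<and> compact (closure {x. f x \<noteq> 0}) \<and> closure {x. f x \<noteq> 0} \<subseteq> W"


section \<open>Meshes\<close>

text \<open>A conforming simplicial mesh of (the closure of) \<open>D\<close>: the cells are closed nondegenerate
  simplices, and \<^const>\<open>triangulation\<close> says that any two of them meet in a common face.\<close>

definition mesh :: "(real^'d) set set \<Rightarrow> (real^'d) set \<Rightarrow> bool" where
  "mesh T D \<longleftrightarrow>
     triangulation T \<and> (\<forall>K \<in> T. int CARD('d) simplex K) \<and> \<Union>T = closure D"

definition mesh_size :: "(real^'d) set set \<Rightarrow> real" where
  "mesh_size T = Max (diameter ` T)"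

definition inradius :: "(real^'d) set \<Rightarrow> real" where
  "inradius K = Sup {r. 0 \<le> r \<and> (\<exists>x. cball x r \<subseteq> K)}"

definition shape_regular :: "real \<Rightarrow> (real^'d) set set \<Rightarrow> bool" where
  "shape_regular \<gamma> T \<longleftrightarrow> (\<forall>K \<in> T. diameter K \<le> \<gamma> * inradius K)"

definition quasi_uniform :: "real \<Rightarrow> (real^'d) set set \<Rightarrow> bool" where
  "quasi_uniform \<gamma> T \<longleftrightarrow> shape_regular \<gamma> T \<and> (\<forall>K \<in> T. mesh_size T \<le> \<gamma> * diameter K)"

definition fitted :: "(real^'d) set set \<Rightarrow> (real^'d) set \<Rightarrow> bool" where
  "fitted T \<Omega> \<longleftrightarrow> (\<exists>\<F>. (\<forall>F \<in> \<F>. \<exists>K \<in> T. F facet_of K) \<and> frontier \<Omega> = \<Union>\<F>)"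


section \<open>Finite element spaces\<close>

definition polynomial_deg_le :: "nat \<Rightarrow> (real^'d \<Rightarrow> real) \<Rightarrow> bool" where
  "polynomial_deg_le p P \<longleftrightarrow>
     (\<exists>c :: ('d \<Rightarrow> nat) \<Rightarrow> real. \<forall>x.
        P x = (\<Sum>a | (\<Sum>i\<in>UNIV. a i) \<le> p. c a * (\<Prod>i\<in>UNIV. x $ i ^ a i)))"

text \<open>Continuous piecewise polynomials on \<open>closure D\<close>; as functions on the whole space they are
  extended by zero, so that equality of functions is equality on \<open>closure D\<close>.\<close>

definition fe_space :: "nat \<Rightarrow> (real^'d) set set \<Rightarrow> (real^'d) set \<Rightarrow> (real^'d \<Rightarrow> real) set" where
  "fe_space p T D =
     {v. continuous_on (closure D) v \<and>
         (\<forall>K \<in> T. \<exists>P. polynomial_deg_le p P \<and> (\<forall>x \<in> K. v x = P x)) \<and>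
         (\<forall>x. x \<notin> closure D \<longrightarrow> v x = 0)}"

text \<open>Because of the extension by zero, vanishing off \<open>\<Omega>\<close> is vanishing on \<open>D - \<Omega>\<close> together with
  a zero trace on the part (if any) of the boundary of \<open>D\<close> that \<open>\<Omega>\<close> touches.\<close>

definition fe_space0 ::
  "nat \<Rightarrow> (real^'d) set set \<Rightarrow> (real^'d) set \<Rightarrow> (real^'d) set \<Rightarrow> (real^'d \<Rightarrow> real) set" where
  "fe_space0 p T D \<Omega> = {v \<in> fe_space p T D. \<forall>x. x \<notin> \<Omega> \<longrightarrow> v x = 0}"

text \<open>The points of the simplices whose barycentric coordinates are multiples of \<open>1/p\<close>.\<close>

definition lagrange_nodes :: "nat \<Rightarrow> (real^'d) set set \<Rightarrow> (real^'d) set" where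
  "lagrange_nodes p T =
     {x. \<exists>K \<in> T. \<exists>m :: real^'d \<Rightarrow> nat.
           (\<Sum>a | a extreme_point_of K. m a) = p \<and>
           x = (\<Sum>a | a extreme_point_of K. (real (m a) / real p) *\<^sub>R a)}"

text \<open>\<open>\<phi> 0, ..., \<phi> (N-1)\<close> is the nodal basis of \<open>V\<close> for the node set \<open>X\<close>, enumerated as
  \<open>x 0, ..., x (N-1)\<close>; linear independence is implied by the duality.\<close>

definition nodal_basis ::
  "(real^'d \<Rightarrow> real) set \<Rightarrow> (real^'d) set \<Rightarrow> nat \<Rightarrow> (nat \<Rightarrow> real^'d) \<Rightarrow> (nat \<Rightarrow> real^'d \<Rightarrow> real) \<Rightarrow> bool"
  where
  "nodal_basis V X N x \<phi> \<longleftrightarrow>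
     bij_betw x {..<N} X \<and>
     (\<forall>i < N. \<phi> i \<in> V) \<and>
     (\<forall>i < N. \<forall>j < N. \<phi> i (x j) = (if i = j then 1 else 0)) \<and>
     (\<forall>v \<in> V. \<exists>c :: nat \<Rightarrow> real. \<forall>y. v y = (\<Sum>i<N. c i * \<phi> i y))"

definition nodal_interpolant ::
  "(real^'d \<Rightarrow> real) set \<Rightarrow> (real^'d) set \<Rightarrow> (real^'d \<Rightarrow> real) \<Rightarrow> (real^'d \<Rightarrow> real) \<Rightarrow> bool" where
  "nodal_interpolant V X f u \<longleftrightarrow> u \<in> V \<and> (\<forall>z \<in> X. u z = f z)"


section \<open>The fractional Laplacian: forms, matrices and data\<close>

definition c_frac :: "nat \<Rightarrow> real \<Rightarrow> real" where
  "c_frac d s =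
     4 powr s * s * Gamma (real d / 2 + s) / (pi powr (real d / 2) * Gamma (1 - s))"

definition frac_dist :: "real \<Rightarrow> real^'d \<Rightarrow> real^'d \<Rightarrow> real" where
  "frac_dist s x y = norm (x - y) powr (real CARD('d) + 2 * s)"

definition a_form ::
  "real \<Rightarrow> (real^'d) set \<Rightarrow> (real^'d \<Rightarrow> real) \<Rightarrow> (real^'d \<Rightarrow> real) \<Rightarrow> real" where
  "a_form s D u v =
     c_frac CARD('d) s / 2 *
       (LINT z : D \<times> D | lborel.
          (u (fst z) - u (snd z)) * (v (fst z) - v (snd z)) / frac_dist s (fst z) (snd z))
     + c_frac CARD('d) s *
       (LINT x : D | lborel. u x * v x * (LINT y : - D | lborel. 1 / frac_dist s x y))"

definition stiffness_matrix ::
  "real \<Rightarrow> (real^'d) set \<Rightarrow> nat \<Rightarrow> (nat \<Rightarrow> real^'d \<Rightarrow> real) \<Rightarrow> real mat" where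
  "stiffness_matrix s D N \<phi> = Matrix.mat N N (\<lambda>(i, j). a_form s D (\<phi> i) (\<phi> j))"

definition mass_matrix :: "(real^'d) set \<Rightarrow> nat \<Rightarrow> (nat \<Rightarrow> real^'d \<Rightarrow> real) \<Rightarrow> real mat" where
  "mass_matrix D N \<phi> = Matrix.mat N N (\<lambda>(i, j). LINT x : D | lborel. \<phi> i x * \<phi> j x)"

definition observation_matrix ::
  "real \<Rightarrow> (real^'d) set \<Rightarrow> nat \<Rightarrow> (nat \<Rightarrow> real^'d) \<Rightarrow> nat \<Rightarrow> (nat \<Rightarrow> real^'d \<Rightarrow> real) \<Rightarrow> real mat" where
  "observation_matrix s \<Omega> M x N \<phi> =
     Matrix.mat M N (\<lambda>(k, i).
       - c_frac CARD('d) s * (LINT y : \<Omega> | lborel. \<phi> i y / frac_dist s (x k) y))"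

text \<open>\<^const>\<open>Lim\<close> is total: nothing is claimed about the existence of the principal value.\<close>

definition pv_operator :: "real \<Rightarrow> (real^'d) set \<Rightarrow> (real^'d \<Rightarrow> real) \<Rightarrow> real^'d \<Rightarrow> real" where
  "pv_operator s D v x =
     c_frac CARD('d) s *
       Lim (at_right 0) (\<lambda>\<epsilon>. LINT y : D - ball x \<epsilon> | lborel. (v x - v y) / frac_dist s x y)"

definition data_vector ::
  "real \<Rightarrow> (real^'d) set \<Rightarrow> nat \<Rightarrow> (nat \<Rightarrow> real^'d) \<Rightarrow> (real^'d \<Rightarrow> real) \<Rightarrow> (real^'d \<Rightarrow> real) \<Rightarrow> real vec" where
  "data_vector s D M x g u = Matrix.vec M (\<lambda>k. g (x k) - pv_operator s D u (x k))"


section \<open>The discrete Tikhonov problem\<close>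

definition tikhonov ::
  "real mat \<Rightarrow> real mat \<Rightarrow> real mat \<Rightarrow> real vec \<Rightarrow> real \<Rightarrow> real vec \<Rightarrow> real" where
  "tikhonov B Wm S \<mu> \<alpha> v =
     (B *\<^sub>v v - \<mu>) \<bullet> (Wm *\<^sub>v (B *\<^sub>v v - \<mu>)) + \<alpha> * (v \<bullet> (S *\<^sub>v v))"

definition sym_pos_def :: "nat \<Rightarrow> real mat \<Rightarrow> bool" where
  "sym_pos_def n A \<longleftrightarrow>
     A \<in> carrier_mat n n \<and> transpose_mat A = A \<and>
     (\<forall>v \<in> carrier_vec n. v \<noteq> 0\<^sub>v n \<longrightarrow> 0 < v \<bullet> (A *\<^sub>v v))"

end

(* On the span of the basis functions, the quadratic form of S is the energy a_R(u, u) plus the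
   squared L^2 norm of u, provided that a_R is bilinear there, i.e. that the singular integrals of
   products of basis functions converge. Basis functions are continuous piecewise polynomials that
   vanish off Omega, hence bounded and Lipschitz on the whole space, so all integrands are dominated
   by multiples of min(1,|x-y|)^2 / |x-y|^(d+2s), whose integral over the whole space is finite.
   Thus S is positive definite, and so is the matrix of the normal equations; completing the square
   identifies its unique solution with the unique minimizer. *)
theory Submission
  imports Defs "Jordan_Normal_Form.Determinant"
begin

no_notation vec_index (infixl "$" 100)
no_notation inner (infix "\<bullet>" 70)

section \<open>Quadratic Tikhonov functionals\<close>

text \<open>Convergence is not a formality here: the Bochner integral is total, with value 0 on
  functions that are not integrable. So \<open>a_form\<close> is defined for all arguments but is
  known to be additive only where the integrands converge, and the sign of its quadratic form cannot
  be read off before that. Near the diagonal two Lipschitz increments leave the exponent 2 - d - 2s,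
  integrable because s < 1; far away boundedness leaves -d - 2s, integrable because s > 0. The
  Lipschitz bound has to be global, since the double integral pairs points of different cells and
  the exterior weight pairs points of the cube with points outside it. The energy enters only as a
  nonnegative quantity. Strictness comes from the mass term: a combination of basis functions takes
  its coefficients as nodal values, and a continuous function that is nonzero at a node is nonzero
  on an open set.\<close>

lemma sym_pos_def_ex1_solution:
  assumes A: "sym_pos_def n A" and b: "b \<in> carrier_vec n"
  shows "\<exists>!v. v \<in> carrier_vec n \<and> A *\<^sub>v v = b"
proof -
  have Ac: "A \<in> carrier_mat n n" and pos: "\<And>v. v \<in> carrier_vec n \<Longrightarrow> v \<noteq> 0\<^sub>v n \<Longrightarrow> 0 < v \<bullet> (A *\<^sub>v v)"
    using A by (auto simp: sym_pos_def_def)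
  have "Determinant.det A \<noteq> 0"
  proof
    assume "Determinant.det A = 0"
    then obtain v where v: "v \<in> carrier_vec n" "v \<noteq> 0\<^sub>v n" "A *\<^sub>v v = 0\<^sub>v n"
      using det_0_iff_vec_prod_zero[OF Ac] by blast
    then show False using pos[of v] by simp
  qed
  \<comment> \<open>The argument \<open>b\<close> fills the record extension of the matrix ring; the
    unit value carries no information.\<close>
  from det_non_zero_imp_unit[OF Ac this, where b = "()"]
  obtain C where C: "C \<in> carrier_mat n n" "C * A = 1\<^sub>m n" "A * C = 1\<^sub>m n"
    by (auto simp: Units_def ring_mat_def)
  show ?thesis
  proof (rule ex1I[of _ "C *\<^sub>v b"])
    show "C *\<^sub>v b \<in> carrier_vec n \<and> A *\<^sub>v (C *\<^sub>v b) = b"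
      using C Ac b by (metis assoc_mult_mat_vec mult_mat_vec_carrier one_mult_mat_vec)
  next
    fix v assume "v \<in> carrier_vec n \<and> A *\<^sub>v v = b"
    then show "v = C *\<^sub>v b"
      using C Ac by (metis assoc_mult_mat_vec one_mult_mat_vec)
  qed
qed

lemma scalar_prod_transpose_mat_vec:
  fixes A :: "'a::comm_semiring_0 mat"
  assumes "A \<in> carrier_mat m n" "u \<in> carrier_vec n" "w \<in> carrier_vec m"
  shows "u \<bullet> (transpose_mat A *\<^sub>v w) = (A *\<^sub>v u) \<bullet> w"
  using assms transpose_vec_mult_scalar[OF assms]
  by (simp add: comm_scalar_prod[of u n] comm_scalar_prod[of w m])

lemma scalar_prod_mat_vec_sym:
  fixes A :: "real mat"
  assumes "A \<in> carrier_mat n n" "transpose_mat A = A" "v \<in> carrier_vec n" "w \<in> carrier_vec n"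
  shows "v \<bullet> (A *\<^sub>v w) = w \<bullet> (A *\<^sub>v v)"
  using scalar_prod_transpose_mat_vec[of A n n v w] assms comm_scalar_prod[of "A *\<^sub>v v" n w] by simp

lemma transpose_smult: "transpose_mat (a \<cdot>\<^sub>m A) = a \<cdot>\<^sub>m transpose_mat A"
  by (rule eq_matI) auto

text \<open>Reduces the normal matrix to the bilinear form behind the functional, so that both its
  positivity and the expansion of the functional become computations with scalar products.\<close>

lemma normal_matrix_form:
  fixes B :: "real mat"
  assumes B: "B \<in> carrier_mat m n" and W: "W \<in> carrier_mat m m" and S: "S \<in> carrier_mat n n"
    and u: "u \<in> carrier_vec n" and y: "y \<in> carrier_vec n"
  shows "u \<bullet> ((transpose_mat B * W * B + \<alpha> \<cdot>\<^sub>m S) *\<^sub>v y) =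
      (B *\<^sub>v u) \<bullet> (W *\<^sub>v (B *\<^sub>v y)) + \<alpha> * (u \<bullet> (S *\<^sub>v y))"
proof -
  have smult: "(\<alpha> \<cdot>\<^sub>m S) *\<^sub>v y = \<alpha> \<cdot>\<^sub>v (S *\<^sub>v y)"
    using S y by (intro eq_vecI) auto
  have "(transpose_mat B * W * B + \<alpha> \<cdot>\<^sub>m S) *\<^sub>v y =
      transpose_mat B *\<^sub>v (W *\<^sub>v (B *\<^sub>v y)) + \<alpha> \<cdot>\<^sub>v (S *\<^sub>v y)"
    using B W S y
    by (subst add_mult_distrib_mat_vec[where nr = n and nc = n])
       (auto simp: assoc_mult_mat_vec[where n\<^sub>1 = n and n\<^sub>2 = m and n\<^sub>3 = n]
         assoc_mult_mat_vec[where n\<^sub>1 = n and n\<^sub>2 = m and n\<^sub>3 = m] smult)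
  moreover have "u \<bullet> (transpose_mat B *\<^sub>v (W *\<^sub>v (B *\<^sub>v y))) = (B *\<^sub>v u) \<bullet> (W *\<^sub>v (B *\<^sub>v y))"
    using B W u y by (intro scalar_prod_transpose_mat_vec) auto
  ultimately show ?thesis
    using B W S u y by (simp add: scalar_prod_add_distrib[where n = n])
qed

text \<open>Since \<open>B\<close> may have a kernel, the misfit part contributes only
  nonnegativity; strictness is supplied by the regularization.\<close>

lemma sym_pos_def_normal_matrix:
  assumes B: "B \<in> carrier_mat m n" and W: "W \<in> carrier_mat m m" "transpose_mat W = W"
    and W_nonneg: "\<And>y. y \<in> carrier_vec m \<Longrightarrow> 0 \<le> y \<bullet> (W *\<^sub>v y)"
    and S: "sym_pos_def n S" and "0 < \<alpha>"
  shows "sym_pos_def n (transpose_mat B * W * B + \<alpha> \<cdot>\<^sub>m S)"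
  unfolding sym_pos_def_def
proof (intro conjI ballI impI)
  have Sc: "S \<in> carrier_mat n n" "transpose_mat S = S"
    and S_pos: "\<And>v. v \<in> carrier_vec n \<Longrightarrow> v \<noteq> 0\<^sub>v n \<Longrightarrow> 0 < v \<bullet> (S *\<^sub>v v)"
    using S by (auto simp: sym_pos_def_def)
  show "transpose_mat B * W * B + \<alpha> \<cdot>\<^sub>m S \<in> carrier_mat n n"
    using B W Sc by auto
  have "transpose_mat (transpose_mat B * W) = W * B"
    using transpose_mult[of "transpose_mat B" n m W m] B W by simp
  then have "transpose_mat (transpose_mat B * W * B) = transpose_mat B * (W * B)"
    using transpose_mult[of "transpose_mat B * W" n m B n] B W by simp
  also have "\<dots> = transpose_mat B * W * B"
    using B W by (intro assoc_mult_mat[symmetric]) auto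
  finally show "transpose_mat (transpose_mat B * W * B + \<alpha> \<cdot>\<^sub>m S) = transpose_mat B * W * B + \<alpha> \<cdot>\<^sub>m S"
    using B W Sc transpose_add[of "transpose_mat B * W * B" n n "\<alpha> \<cdot>\<^sub>m S"]
    by (simp add: transpose_smult)
  fix v :: "real vec" assume v: "v \<in> carrier_vec n" "v \<noteq> 0\<^sub>v n"
  have "0 \<le> (B *\<^sub>v v) \<bullet> (W *\<^sub>v (B *\<^sub>v v))"
    using B v by (intro W_nonneg) auto
  moreover have "0 < \<alpha> * (v \<bullet> (S *\<^sub>v v))"
    using S_pos[OF v] \<open>0 < \<alpha>\<close> by simp
  ultimately show "0 < v \<bullet> ((transpose_mat B * W * B + \<alpha> \<cdot>\<^sub>m S) *\<^sub>v v)"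
    by (simp add: normal_matrix_form[OF B W(1) Sc(1) v(1) v(1)])
qed

text \<open>The exact second-order expansion at a solution of the normal equations: the functional
  is quadratic, and its linear part there vanishes.\<close>

lemma tikhonov_add:
  assumes B: "B \<in> carrier_mat m n" and W: "W \<in> carrier_mat m m" "transpose_mat W = W"
    and S: "S \<in> carrier_mat n n" "transpose_mat S = S" and \<mu>: "\<mu> \<in> carrier_vec m"
    and v: "v \<in> carrier_vec n" and w: "w \<in> carrier_vec n"
    and eq: "(transpose_mat B * W * B + \<alpha> \<cdot>\<^sub>m S) *\<^sub>v v = transpose_mat B *\<^sub>v (W *\<^sub>v \<mu>)"
  shows "tikhonov B W S \<mu> \<alpha> (v + w) =
    tikhonov B W S \<mu> \<alpha> v + w \<bullet> ((transpose_mat B * W * B + \<alpha> \<cdot>\<^sub>m S) *\<^sub>v w)"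
proof -
  note H = normal_matrix_form[OF B W(1) S(1)]
  let ?r = "B *\<^sub>v v - \<mu>" and ?q = "B *\<^sub>v w"
  have c: "?r \<in> carrier_vec m" "?q \<in> carrier_vec m" "B *\<^sub>v v \<in> carrier_vec m"
    "W *\<^sub>v ?r \<in> carrier_vec m" "W *\<^sub>v ?q \<in> carrier_vec m" "W *\<^sub>v \<mu> \<in> carrier_vec m"
    "W *\<^sub>v (B *\<^sub>v v) \<in> carrier_vec m"
    "S *\<^sub>v v \<in> carrier_vec n" "S *\<^sub>v w \<in> carrier_vec n"
    using B W S \<mu> v w by auto
  have "w \<bullet> (transpose_mat B *\<^sub>v (W *\<^sub>v \<mu>)) = ?q \<bullet> (W *\<^sub>v \<mu>)"
    using B w c by (intro scalar_prod_transpose_mat_vec) auto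
  \<comment> \<open>The left-hand side is half the directional derivative of the functional at
    \<open>v\<close> along \<open>w\<close>.\<close>
  then have cross: "?q \<bullet> (W *\<^sub>v ?r) + \<alpha> * (w \<bullet> (S *\<^sub>v v)) = 0"
    using H[OF w v, of \<alpha>] eq c \<mu> W(1)
    by (simp add: mult_minus_distrib_mat_vec[where nr = m and nc = m] scalar_prod_minus_distrib[where n = m])
  have "B *\<^sub>v (v + w) - \<mu> = ?r + ?q"
    using B v w \<mu> c by (intro eq_vecI) (auto simp: mult_add_distrib_mat_vec[where nr = m and nc = n])
  moreover have "(?r + ?q) \<bullet> (W *\<^sub>v (?r + ?q)) =
      ?r \<bullet> (W *\<^sub>v ?r) + 2 * (?q \<bullet> (W *\<^sub>v ?r)) + ?q \<bullet> (W *\<^sub>v ?q)"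
    using c W scalar_prod_mat_vec_sym[OF W c(1,2)]
    by (simp add: mult_add_distrib_mat_vec[where nr = m and nc = m]
        scalar_prod_add_distrib[where n = m] add_scalar_prod_distrib[where n = m])
  moreover have "(v + w) \<bullet> (S *\<^sub>v (v + w)) = v \<bullet> (S *\<^sub>v v) + 2 * (w \<bullet> (S *\<^sub>v v)) + w \<bullet> (S *\<^sub>v w)"
    using c S v w scalar_prod_mat_vec_sym[OF S v w]
    by (simp add: mult_add_distrib_mat_vec[where nr = n and nc = n]
        scalar_prod_add_distrib[where n = n] add_scalar_prod_distrib[where n = n])
  ultimately show ?thesis
    using cross by (simp add: tikhonov_def H[OF w w] algebra_simps)
qed

text \<open>The expansion at the solution \<open>v0\<close> makes the value at every other vector
  strictly larger. This single inequality gives both directions, without any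
  differentiation.\<close>

lemma tikhonov_minimizer:
  assumes B: "B \<in> carrier_mat m n" and W: "W \<in> carrier_mat m m" "transpose_mat W = W"
    and W_nonneg: "\<And>y. y \<in> carrier_vec m \<Longrightarrow> 0 \<le> y \<bullet> (W *\<^sub>v y)"
    and S: "sym_pos_def n S" and \<mu>: "\<mu> \<in> carrier_vec m" and \<alpha>: "0 < \<alpha>"
  shows "v \<in> carrier_vec n \<and>
      (transpose_mat B * W * B + \<alpha> \<cdot>\<^sub>m S) *\<^sub>v v = transpose_mat B *\<^sub>v (W *\<^sub>v \<mu>) \<longleftrightarrow>
    is_arg_min (tikhonov B W S \<mu> \<alpha>) (\<lambda>w. w \<in> carrier_vec n) v"
proof -
  let ?H = "transpose_mat B * W * B + \<alpha> \<cdot>\<^sub>m S" and ?J = "tikhonov B W S \<mu> \<alpha>"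
  have Sc: "S \<in> carrier_mat n n" "transpose_mat S = S"
    using S by (auto simp: sym_pos_def_def)
  have spd: "sym_pos_def n ?H"
    using assms by (intro sym_pos_def_normal_matrix)
  have "transpose_mat B *\<^sub>v (W *\<^sub>v \<mu>) \<in> carrier_vec n" using B W \<mu> by auto
  from sym_pos_def_ex1_solution[OF spd this]
  obtain v0 where v0: "v0 \<in> carrier_vec n" "?H *\<^sub>v v0 = transpose_mat B *\<^sub>v (W *\<^sub>v \<mu>)"
    and uniq: "\<And>v. v \<in> carrier_vec n \<and> ?H *\<^sub>v v = transpose_mat B *\<^sub>v (W *\<^sub>v \<mu>) \<Longrightarrow> v = v0"
    by blast
  have less: "?J v0 < ?J w" if w: "w \<in> carrier_vec n" "w \<noteq> v0" for w
  proof -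
    have "w - v0 \<noteq> 0\<^sub>v n"
    proof
      assume "w - v0 = 0\<^sub>v n"
      then have "vec_index w i = vec_index v0 i" if "i < n" for i
        using that w(1) v0(1) by (metis carrier_vecD eq_iff_diff_eq_0 index_minus_vec(1) index_zero_vec(1))
      then show False using w v0(1) by auto
    qed
    then have "0 < (w - v0) \<bullet> (?H *\<^sub>v (w - v0))"
      using spd w v0 by (auto simp: sym_pos_def_def)
    moreover have "v0 + (w - v0) = w" using w v0 by (intro eq_vecI) auto
    ultimately show ?thesis
      using tikhonov_add[OF B W Sc \<mu> v0(1) _ v0(2), of "w - v0"] w v0 by simp
  qed
  show ?thesis
  proof
    assume "v \<in> carrier_vec n \<and> ?H *\<^sub>v v = transpose_mat B *\<^sub>v (W *\<^sub>v \<mu>)"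
    then have "v = v0" by (rule uniq)
    then show "is_arg_min ?J (\<lambda>w. w \<in> carrier_vec n) v"
      unfolding is_arg_min_def using v0(1) less by (metis less_asym)
  next
    assume "is_arg_min ?J (\<lambda>w. w \<in> carrier_vec n) v"
    then have "v \<in> carrier_vec n" "\<not> ?J v0 < ?J v"
      using v0(1) by (auto simp: is_arg_min_def)
    then have "v = v0" using less by blast
    then show "v \<in> carrier_vec n \<and> ?H *\<^sub>v v = transpose_mat B *\<^sub>v (W *\<^sub>v \<mu>)" using v0 by simp
  qed
qed

lemma quadratic_form_mat:
  assumes "v \<in> carrier_vec n"
  shows "v \<bullet> (Matrix.mat n n a *\<^sub>v v) =
    (\<Sum>i<n. \<Sum>j<n. vec_index v i * vec_index v j * (a (i, j) :: real))"
  using assms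
  by (auto simp: scalar_prod_def sum_distrib_left lessThan_atLeast0 mult_ac intro!: sum.cong)

section \<open>Gram matrices of weighted integrals\<close>

text \<open>Integrability of each product is what lets the finite sums pass through the integral.
  The weight \<open>k\<close> is left open to cover three uses: the singular kernel on pairs of
  points, the exterior weight, and the constant 1 for mass matrices.\<close>

lemma gram_quadratic_form:
  fixes F :: "nat \<Rightarrow> 'a \<Rightarrow> real"
  assumes "\<And>i j. i < n \<Longrightarrow> j < n \<Longrightarrow> set_integrable M A (\<lambda>x. F i x * F j x * k x)"
  shows "set_integrable M A (\<lambda>x. (\<Sum>i<n. c i * F i x)\<^sup>2 * k x)"
    and "(\<Sum>i<n. \<Sum>j<n. c i * c j * (LINT x:A|M. F i x * F j x * k x)) =
      (LINT x:A|M. (\<Sum>i<n. c i * F i x)\<^sup>2 * k x)"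
proof -
  have eq: "(\<Sum>i<n. c i * F i x)\<^sup>2 * k x = (\<Sum>i<n. \<Sum>j<n. c i * c j * (F i x * F j x * k x))" for x
    by (subst power2_eq_square, subst sum_product, subst sum_distrib_right, rule sum.cong[OF refl],
        subst sum_distrib_right, rule sum.cong[OF refl]) (simp add: mult_ac)
  \<comment> \<open>With the indicator inside the integrand, linearity of the plain integral
    applies.\<close>
  define G where "G i j x = indicator A x * (F i x * F j x * k x)" for i j x
  have int: "integrable M (\<lambda>x. c i * c j * G i j x)" if "i \<in> {..<n}" "j \<in> {..<n}" for i j
    using assms[of i j] that by (simp add: set_integrable_def G_def)
  have ind: "indicator A x * ((\<Sum>i<n. c i * F i x)\<^sup>2 * k x) = (\<Sum>i<n. \<Sum>j<n. c i * c j * G i j x)" for x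
    unfolding eq G_def sum_distrib_left by (intro sum.cong refl) (simp only: mult_ac)
  have ints: "integrable M (\<lambda>x. \<Sum>j<n. c i * c j * G i j x)" if "i \<in> {..<n}" for i
    by (intro Bochner_Integration.integrable_sum int that)
  show "set_integrable M A (\<lambda>x. (\<Sum>i<n. c i * F i x)\<^sup>2 * k x)"
    unfolding set_integrable_def real_scaleR_def ind by (intro Bochner_Integration.integrable_sum ints)
  have "(LINT x:A|M. (\<Sum>i<n. c i * F i x)\<^sup>2 * k x) =
      (\<Sum>i<n. LINT x|M. (\<Sum>j<n. c i * c j * G i j x))"
    unfolding set_lebesgue_integral_def real_scaleR_def ind
    by (intro Bochner_Integration.integral_sum ints)
  also have "\<dots> = (\<Sum>i<n. \<Sum>j<n. LINT x|M. c i * c j * G i j x)"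
    by (intro sum.cong refl Bochner_Integration.integral_sum int)
  also have "\<dots> = (\<Sum>i<n. \<Sum>j<n. c i * c j * (LINT x:A|M. F i x * F j x * k x))"
    by (simp add: G_def set_lebesgue_integral_def)
  finally show "(\<Sum>i<n. \<Sum>j<n. c i * c j * (LINT x:A|M. F i x * F j x * k x)) =
      (LINT x:A|M. (\<Sum>i<n. c i * F i x)\<^sup>2 * k x)" ..
qed

corollary gram_quadratic_form_nonneg:
  fixes F :: "nat \<Rightarrow> 'a \<Rightarrow> real"
  assumes "\<And>i j. i < n \<Longrightarrow> j < n \<Longrightarrow> set_integrable M A (\<lambda>x. F i x * F j x * k x)"
    and "\<And>x. 0 \<le> k x"
  shows "0 \<le> (\<Sum>i<n. \<Sum>j<n. c i * c j * (LINT x:A|M. F i x * F j x * k x))"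
proof -
  have "0 \<le> (LINT x:A|M. (\<Sum>i<n. c i * F i x)\<^sup>2 * k x)"
    unfolding set_lebesgue_integral_def
    by (intro Bochner_Integration.integral_nonneg) (simp add: assms(2))
  then show ?thesis
    using gram_quadratic_form(2)[OF assms(1), where c = c] by simp
qed

section \<open>Lipschitz continuity of finite element functions\<close>

text \<open>On a bounded set both Lipschitz factors are bounded, so the product rule for increments
  gives a finite constant.\<close>

lemma lipschitz_on_bounded_mult:
  fixes f g :: "'a::heine_borel \<Rightarrow> real"
  assumes S: "bounded S" and f: "A-lipschitz_on S f" and g: "B-lipschitz_on S g"
  shows "\<exists>L. L-lipschitz_on S (\<lambda>x. f x * g x)"
proof -
  have "bounded (f ` S)" "bounded (g ` S)"
    using bounded_uniformly_continuous_image[OF lipschitz_on_uniformly_continuous[OF f] S]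
      bounded_uniformly_continuous_image[OF lipschitz_on_uniformly_continuous[OF g] S] by auto
  then obtain F G where F: "0 < F" "\<And>x. x \<in> S \<Longrightarrow> \<bar>f x\<bar> \<le> F"
    and G: "0 < G" "\<And>x. x \<in> S \<Longrightarrow> \<bar>g x\<bar> \<le> G"
    by (auto simp: bounded_pos)
  have nn: "0 \<le> A" "0 \<le> B" using f g by (auto simp: lipschitz_on_def)
  have "(F * B + G * A)-lipschitz_on S (\<lambda>x. f x * g x)"
  proof (rule lipschitz_onI)
    fix x y assume xy: "x \<in> S" "y \<in> S"
    have "\<bar>f x * g x - f y * g y\<bar> = \<bar>f x * (g x - g y) + g y * (f x - f y)\<bar>"
      by (simp add: algebra_simps)
    also have "\<dots> \<le> \<bar>f x\<bar> * \<bar>g x - g y\<bar> + \<bar>g y\<bar> * \<bar>f x - f y\<bar>"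
      by (metis abs_mult abs_triangle_ineq)
    also have "\<dots> \<le> F * (B * dist x y) + G * (A * dist x y)"
      using F G xy lipschitz_onD[OF f xy] lipschitz_onD[OF g xy] nn
      by (intro add_mono mult_mono) (auto simp: dist_real_def)
    finally show "dist (f x * g x) (f y * g y) \<le> (F * B + G * A) * dist x y"
      by (simp add: dist_real_def algebra_simps)
  qed (use F G nn in auto)
  then show ?thesis by blast
qed

lemma lipschitz_on_bounded_prod:
  fixes f :: "'i \<Rightarrow> 'a::heine_borel \<Rightarrow> real"
  assumes "bounded S" "\<And>i. i \<in> I \<Longrightarrow> \<exists>L. L-lipschitz_on S (f i)"
  shows "\<exists>L. L-lipschitz_on S (\<lambda>x. \<Prod>i\<in>I. f i x)"
  using assms(2)
proof (induction I rule: infinite_finite_induct)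
  case (insert i I)
  then obtain A B where "A-lipschitz_on S (f i)" "B-lipschitz_on S (\<lambda>x. \<Prod>i\<in>I. f i x)" by blast
  from lipschitz_on_bounded_mult[OF assms(1) this] show ?case using insert.hyps by simp
qed (auto intro: lipschitz_on_constant)

lemma lipschitz_on_ex_sum:
  fixes f :: "'i \<Rightarrow> 'a::metric_space \<Rightarrow> real"
  assumes "\<And>i. i \<in> I \<Longrightarrow> \<exists>L. L-lipschitz_on S (f i)"
  shows "\<exists>L. L-lipschitz_on S (\<lambda>x. \<Sum>i\<in>I. f i x)"
  using assms
proof (induction I rule: infinite_finite_induct)
  case (insert i I)
  then obtain A B where "A-lipschitz_on S (f i)" "B-lipschitz_on S (\<lambda>x. \<Sum>i\<in>I. f i x)" by blast
  from lipschitz_on_add[OF this] show ?case using insert.hyps by auto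
qed (auto intro: lipschitz_on_constant)

lemma polynomial_deg_le_lipschitz_on:
  fixes S :: "(real^'d) set"
  assumes "polynomial_deg_le p P" and S: "bounded S"
  shows "\<exists>L. L-lipschitz_on S P"
proof -
  obtain c where P: "P = (\<lambda>x. \<Sum>a | (\<Sum>i\<in>UNIV. a i) \<le> p. c a * (\<Prod>i\<in>UNIV. x $ i ^ a i))"
    using assms(1) by (auto simp: polynomial_deg_le_def fun_eq_iff)
  have coord: "1-lipschitz_on S (\<lambda>x. x $ i)" for i
    by (rule lipschitz_onI) (auto simp: dist_vec_nth_le)
  have "\<exists>L. L-lipschitz_on S (\<lambda>x. x $ i ^ k)" for i k
    \<comment> \<open>A power is a product of \<open>k\<close> equal factors, so the product rule
      covers monomials.\<close>
    using lipschitz_on_bounded_prod[OF S, of "{..<k}" "\<lambda>_ x. x $ i"] coord by auto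
  then have "\<exists>L. L-lipschitz_on S (\<lambda>x. \<Prod>i\<in>UNIV. x $ i ^ a i)" for a
    by (intro lipschitz_on_bounded_prod[OF S]) auto
  then have "\<exists>L. L-lipschitz_on S (\<lambda>x. c a * (\<Prod>i\<in>UNIV. x $ i ^ a i))" for a
    using lipschitz_on_cmult_real by blast
  then show ?thesis unfolding P by (rule lipschitz_on_ex_sum)
qed

text \<open>Two points in different pieces are joined by a segment. Its parameter interval is
  covered by finitely many closed preimages of the pieces, and gluing on an interval keeps the
  constant. The pieces themselves may have any shape.\<close>

lemma lipschitz_on_UNIV_closed_Union:
  fixes f :: "'a::real_normed_vector \<Rightarrow> 'b::metric_space"
  assumes lip: "\<And>U. U \<in> \<U> \<Longrightarrow> M-lipschitz_on U f" and closed: "\<And>U. U \<in> \<U> \<Longrightarrow> closed U"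
    and "finite \<U>" "0 \<le> M" "\<Union>\<U> = UNIV"
  shows "M-lipschitz_on UNIV f"
proof (rule lipschitz_onI)
  fix x y :: 'a
  define \<gamma> where "\<gamma> t = x + t *\<^sub>R (y - x)" for t :: real
  have \<gamma>: "dist (\<gamma> s) (\<gamma> t) = norm (y - x) * dist s t" for s t
    by (simp add: \<gamma>_def dist_norm flip: scaleR_diff_left)
  have "(M * norm (y - x))-lipschitz_on {0..1} (f \<circ> \<gamma>)"
  proof (rule lipschitz_on_closed_Union[where I = \<U> and U = "\<lambda>U. \<gamma> -` U"])
    fix U assume U: "U \<in> \<U>"
    show "(M * norm (y - x))-lipschitz_on (\<gamma> -` U) (f \<circ> \<gamma>)"
      using lipschitz_onD[OF lip[OF U], of "\<gamma> _" "\<gamma> _"] \<open>0 \<le> M\<close>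
      by (intro lipschitz_onI) (auto simp: \<gamma> mult.assoc)
  next
    fix U assume U: "U \<in> \<U>"
    show "closed (\<gamma> -` U)"
      using closed[OF U] unfolding \<gamma>_def by (intro closed_vimage continuous_intros)
  next
    show "{0..1} \<subseteq> (\<Union>U\<in>\<U>. \<gamma> -` U)"
      using \<open>\<Union>\<U> = UNIV\<close> by blast
  qed (use assms in auto)
  from lipschitz_onD[OF this, of 0 1] show "dist (f x) (f y) \<le> M * dist x y"
    by (simp add: \<gamma>_def dist_norm norm_minus_commute)
qed (fact assms)

text \<open>The cells fill the closure of \<open>D\<close>, so together with the closed set
  \<open>- D\<close> they are finitely many closed sets covering the space. The function is
  polynomial on each cell and zero on \<open>- D\<close>.\<close>

lemma fe_space0_lipschitz:
  fixes D \<Omega> :: "(real^'d) set"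
  assumes u: "u \<in> fe_space0 p T D \<Omega>" and T: "mesh T D" and D: "open D" "\<Omega> \<subseteq> D"
  shows "\<exists>L. L-lipschitz_on UNIV u"
proof -
  have "triangulation T" and simplices: "\<forall>K\<in>T. int CARD('d) simplex K" and T_Un: "\<Union>T = closure D"
    using T by (simp_all add: mesh_def)
  then have fin: "finite T" by (simp add: triangulation_def)
  have cells: "polytope K" if "K \<in> T" for K
    using simplices that simplex_imp_polytope by blast
  have pieces: "\<forall>K\<in>T. \<exists>P. polynomial_deg_le p P \<and> (\<forall>x\<in>K. u x = P x)"
    and u0: "\<And>x. x \<notin> \<Omega> \<Longrightarrow> u x = 0"
    using u by (simp_all add: fe_space0_def fe_space_def)
  have "\<exists>L. L-lipschitz_on K u" if "K \<in> T" for K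
  proof -
    from bspec[OF pieces that]
    obtain P where P: "polynomial_deg_le p P \<and> (\<forall>x\<in>K. u x = P x)" ..
    from polynomial_deg_le_lipschitz_on[OF conjunct1[OF P] polytope_imp_bounded[OF cells[OF that]]]
    obtain L where "L-lipschitz_on K P" ..
    then have "L-lipschitz_on K u"
      by (rule lipschitz_on_transform) (use P in blast)
    then show ?thesis ..
  qed
  then have "\<forall>K\<in>T. \<exists>L. L-lipschitz_on K u" by blast
  from bchoice[OF this] obtain L where L: "\<And>K. K \<in> T \<Longrightarrow> (L K)-lipschitz_on K u" by blast
  have L0: "0 \<le> L K" if "K \<in> T" for K using L[OF that] by (simp add: lipschitz_on_def)
  \<comment> \<open>A sum instead of a maximum: it dominates every \<open>L K\<close> and also makes
    sense for an empty mesh.\<close>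
  define M where "M = (\<Sum>K\<in>T. L K)"
  have LM: "L K \<le> M" if "K \<in> T" for K
    unfolding M_def using fin L0 that by (intro member_le_sum) auto
  have M0: "0 \<le> M" unfolding M_def using L0 by (intro sum_nonneg)
  have "M-lipschitz_on UNIV u"
  proof (rule lipschitz_on_UNIV_closed_Union[where \<U> = "insert (- D) T"])
    fix U assume U: "U \<in> insert (- D) T"
    show "M-lipschitz_on U u"
    proof (cases "U \<in> T")
      case True
      then show ?thesis using L LM by (meson lipschitz_on_le)
    next
      case False
      then have "u x = 0" if "x \<in> U" for x
        using U that u0 D by blast
      then show ?thesis using M0 by (auto intro!: lipschitz_onI)
    qed
    show "closed U" using U D cells polytope_imp_closed by auto
  qed (use fin M0 T_Un closure_subset in auto)
  then show ?thesis by blast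
qed

lemma lipschitz_bounded_support:
  fixes u :: "'a::euclidean_space \<Rightarrow> real"
  assumes u: "L-lipschitz_on UNIV u" and supp: "\<And>x. x \<notin> \<Omega> \<Longrightarrow> u x = 0" and \<Omega>: "bounded \<Omega>"
  shows "\<exists>C\<ge>0. \<forall>x y. \<bar>u x - u y\<bar> \<le> C * min 1 (norm (x - y))"
proof -
  have "bounded (u ` \<Omega>)"
    using bounded_uniformly_continuous_image[OF lipschitz_on_uniformly_continuous \<Omega>]
      lipschitz_on_subset[OF u subset_UNIV] by blast
  then obtain m where m: "0 < m" "\<And>x. x \<in> \<Omega> \<Longrightarrow> \<bar>u x\<bar> \<le> m" by (auto simp: bounded_pos)
  then have um: "\<bar>u x\<bar> \<le> m" for x using supp[of x] by (cases "x \<in> \<Omega>") auto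
  have L: "0 \<le> L" using u by (simp add: lipschitz_on_def)
  \<comment> \<open>The slope \<open>L\<close> serves pairs at distance at most 1, twice the bound
    \<open>m\<close> on the values serves the others; the sum covers both.\<close>
  have "\<bar>u x - u y\<bar> \<le> (L + 2 * m) * min 1 (norm (x - y))" for x y
  proof (cases "norm (x - y) \<le> 1")
    case True
    have "\<bar>u x - u y\<bar> \<le> L * norm (x - y)"
      using lipschitz_onD[OF u, of x y] by (simp add: dist_norm)
    also have "\<dots> \<le> (L + 2 * m) * norm (x - y)" using m by (intro mult_right_mono) auto
    finally show ?thesis using True by (simp add: min_def)
  next
    case False
    then show ?thesis using um[of x] um[of y] L by (simp add: min_def)
  qed
  then show ?thesis using L m by (intro exI[of _ "L + 2 * m"]) auto
qed

section \<open>The singular kernel\<close>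

text \<open>The numerator truncates \<open>\<bar>w\<bar>\<^sup>2\<close> at \<open>1\<close>, as products of increments of bounded Lipschitz
  functions do.\<close>
definition frac_kernel :: "real \<Rightarrow> 'a::euclidean_space \<Rightarrow> real" where
  "frac_kernel s w = (min 1 (norm w))\<^sup>2 / norm w powr (real DIM('a) + 2 * s)"

lemma frac_kernel_nonneg: "0 \<le> frac_kernel s w"
  by (simp add: frac_kernel_def)

lemma frac_kernel_minus: "frac_kernel s (x - y) = frac_kernel s (y - x)"
  by (simp add: frac_kernel_def norm_minus_commute)

lemma borel_measurable_frac_kernel [measurable]: "frac_kernel s \<in> borel_measurable borel"
  unfolding frac_kernel_def by measurable

text \<open>Writing the dyadic radii as \<open>2 ^ n\<close> and \<open>1 / 2 ^ n\<close> keeps the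
  index a natural number, so that the shells can be summed by ordinary series.\<close>

lemma dyadic_bracket:
  fixes t :: real
  assumes "0 < t"
  shows "\<exists>n::nat. \<exists>r \<in> {2 ^ n, 1 / 2 ^ n}. r \<le> t \<and> t < 2 * r"
proof -
  define k where "k = \<lfloor>log 2 t\<rfloor>"
  have k: "2 powi k \<le> t" "t < 2 * 2 powi k"
  proof -
    have "2 powr (real_of_int k) \<le> 2 powr (log 2 t)" "2 powr (log 2 t) < 2 powr (real_of_int k + 1)"
      unfolding k_def by (auto simp del: powr_log_cancel)
    then show "2 powi k \<le> t" "t < 2 * 2 powi k"
      using assms by (auto simp: powr_add powr_real_of_int')
  qed
  show ?thesis
  proof (cases "0 \<le> k")
    case True
    then have "2 powi k = (2::real) ^ nat k" by (simp add: power_int_def)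
    then show ?thesis using k by (intro exI[of _ "nat k"]) auto
  next
    case False
    then have "2 powi k = (1::real) / 2 ^ nat (- k)" by (simp add: power_int_def field_simps)
    then show ?thesis using k by (intro exI[of _ "nat (- k)"]) auto
  qed
qed

text \<open>On the shell \<open>r \<le> \<bar>w\<bar> < 2r\<close> the kernel is at most \<open>g r\<close>, whose integral is of order
  \<open>r\<^sup>2\<^sup>-\<^sup>2\<^sup>s\<close> for \<open>r \<le> 1\<close> and \<open>r\<^sup>-\<^sup>2\<^sup>s\<close> for \<open>r \<ge> 1\<close>: over dyadic \<open>r\<close> both are geometric.\<close>
lemma integrable_frac_kernel:
  assumes s: "0 < s" "s < 1"
  shows "integrable lborel (frac_kernel s :: 'a::euclidean_space \<Rightarrow> real)"
proof -
  define e where "e = real DIM('a) + 2 * s"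
  \<comment> \<open>The factor 4 is the square of the 2 lost in replacing \<open>norm w\<close> by
    \<open>r\<close> in the numerator. Taking the whole ball instead of the shell costs only a
    constant and makes the volume explicit; \<open>C\<close> collects these constants.\<close>
  define g where "g r w = 4 * (min 1 r)\<^sup>2 / r powr e * indicator (ball 0 (2 * r)) w" for r and w :: 'a
  define C where "C = 4 * 2 ^ DIM('a) * unit_ball_vol (real DIM('a))"
  have C: "0 \<le> C" by (simp add: C_def)
  have g0: "0 \<le> g r w" for r w by (simp add: g_def)
  have g_meas [measurable]: "g r \<in> borel_measurable borel" for r
    unfolding g_def by (intro borel_measurable_times borel_measurable_const borel_measurable_indicator) auto
  have dom: "frac_kernel s w \<le> g r w" if r: "0 < r" "r \<le> norm w" "norm w < 2 * r" for r and w :: 'a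
  proof -
    have "(min 1 (norm w))\<^sup>2 \<le> (2 * min 1 r)\<^sup>2"
      using r by (intro power_mono) (auto simp: min_def)
    moreover have "r powr e \<le> norm w powr e"
      using r s by (intro powr_mono2) (auto simp: e_def)
    ultimately have "(min 1 (norm w))\<^sup>2 / norm w powr e \<le> (2 * min 1 r)\<^sup>2 / r powr e"
      using r by (intro frac_le) auto
    then show ?thesis using r by (simp add: frac_kernel_def g_def e_def power_mult_distrib)
  qed
  have int_g: "(\<integral>\<^sup>+w. g r w \<partial>lborel) = ennreal (C * ((min 1 r)\<^sup>2 * r powr (- 2 * s)))" if "0 < r" for r
  proof -
    have "(\<integral>\<^sup>+w. g r w \<partial>lborel) =
        (\<integral>\<^sup>+w. ennreal (4 * (min 1 r)\<^sup>2 / r powr e) * indicator (ball 0 (2 * r)) w \<partial>(lborel :: 'a measure))"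
      by (intro nn_integral_cong) (auto simp: g_def indicator_def)
    also have "\<dots> = ennreal (4 * (min 1 r)\<^sup>2 / r powr e) * emeasure lborel (ball (0::'a) (2 * r))"
      by (intro nn_integral_cmult_indicator) auto
    also have "\<dots> = ennreal (4 * (min 1 r)\<^sup>2 / r powr e * (unit_ball_vol (real DIM('a)) * (2 * r) ^ DIM('a)))"
      using that by (subst emeasure_ball) (auto simp flip: ennreal_mult)
    also have "4 * (min 1 r)\<^sup>2 / r powr e * (unit_ball_vol (real DIM('a)) * (2 * r) ^ DIM('a)) =
        C * ((min 1 r)\<^sup>2 * r powr (- 2 * s))"
      using that by (simp add: C_def e_def powr_add powr_minus powr_realpow power_mult_distrib field_simps)
    finally show ?thesis .
  qed
  \<comment> \<open>Ratios of the series over \<open>r = 2 ^ n\<close> and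
    \<open>r = 1 / 2 ^ n\<close>; they lie below 1 because s > 0 and s < 1 respectively.\<close>
  define q1 q2 where "q1 = 2 powr (- 2 * s)" and "q2 = 2 powr (2 * s - 2)"
  have q: "0 \<le> q1" "q1 < 1" "0 \<le> q2" "q2 < 1"
    using s by (auto simp: q1_def q2_def powr_less_one)
  have int1: "(\<integral>\<^sup>+w. g (2 ^ n) w \<partial>lborel) = ennreal (C * q1 ^ n)" for n
  proof -
    have "(2 ^ n) powr (- 2 * s) = q1 ^ n"
      by (simp add: q1_def powr_powr mult.commute flip: powr_realpow)
    then show ?thesis by (simp add: int_g)
  qed
  have int2: "(\<integral>\<^sup>+w. g (1 / 2 ^ n) w \<partial>lborel) = ennreal (C * q2 ^ n)" for n
  proof -
    have "1 / 2 ^ n = 2 powr (- real n)" by (simp add: powr_minus powr_realpow divide_inverse)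
    moreover have "(2 powr (- real n))\<^sup>2 = 2 powr (- 2 * real n)"
      by (simp add: power2_eq_square flip: powr_add)
    ultimately have "(1 / 2 ^ n)\<^sup>2 * (1 / 2 ^ n) powr (- 2 * s) = 2 powr (- 2 * real n + 2 * s * real n)"
      by (simp add: powr_powr algebra_simps flip: powr_add)
    also have "\<dots> = q2 ^ n"
      by (simp add: q2_def powr_powr algebra_simps flip: powr_realpow)
    finally have "(1 / 2 ^ n)\<^sup>2 * (1 / 2 ^ n) powr (- 2 * s) = q2 ^ n" .
    then show ?thesis by (simp add: int_g)
  qed
  have "(\<integral>\<^sup>+w. frac_kernel s (w::'a) \<partial>lborel) \<le>
      (\<integral>\<^sup>+w. (\<Sum>n. ennreal (g (2 ^ n) w) + ennreal (g (1 / 2 ^ n) w)) \<partial>(lborel :: 'a measure))"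
  proof (intro nn_integral_mono)
    fix w :: 'a
    show "ennreal (frac_kernel s w) \<le> (\<Sum>n. ennreal (g (2 ^ n) w) + ennreal (g (1 / 2 ^ n) w))"
    \<comment> \<open>No shell contains the origin, but the numerator of the kernel vanishes
      there.\<close>
    proof (cases "w = 0")
      case False
      then have "0 < norm w" by simp
      from dyadic_bracket[OF this]
      obtain n r where r: "r = 2 ^ n \<or> r = 1 / 2 ^ n" "r \<le> norm w" "norm w < 2 * r" by blast
      then have "0 < r" by auto
      from dom[OF this r(2,3)] have "ennreal (frac_kernel s w) \<le> ennreal (g r w)"
        by (rule ennreal_leI)
      also have "\<dots> \<le> ennreal (g (2 ^ n) w) + ennreal (g (1 / 2 ^ n) w)"
        using r(1) by auto
      also have "\<dots> = (\<Sum>k\<in>{n}. ennreal (g (2 ^ k) w) + ennreal (g (1 / 2 ^ k) w))" by simp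
      also have "\<dots> \<le> (\<Sum>n. ennreal (g (2 ^ n) w) + ennreal (g (1 / 2 ^ n) w))"
        by (intro sum_le_suminf) auto
      finally show ?thesis .
    qed (simp add: frac_kernel_def)
  qed
  also have "\<dots> = (\<Sum>n. \<integral>\<^sup>+w. ennreal (g (2 ^ n) w) + ennreal (g (1 / 2 ^ n) w) \<partial>(lborel :: 'a measure))"
    by (intro nn_integral_suminf) measurable
  also have "\<dots> = (\<Sum>n. ennreal (C * q1 ^ n + C * q2 ^ n))"
    using C q by (intro suminf_cong) (simp add: nn_integral_add int1 int2)
  also have "\<dots> < \<infinity>"
  proof -
    have "summable (\<lambda>n. C * q1 ^ n + C * q2 ^ n)"
      using q by (intro summable_add summable_mult summable_geometric) auto
    then show ?thesis
      using C q by (subst suminf_ennreal2) auto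
  qed
  finally show ?thesis
    by (intro integrableI_nonneg) (auto simp: frac_kernel_nonneg)
qed

lemma
  fixes f :: "'a::euclidean_space \<Rightarrow> real"
  assumes f: "integrable lborel f"
  shows integrable_lborel_minus_left: "integrable lborel (\<lambda>y. f (y - x))"
    and integral_lborel_minus_left: "(LINT y|lborel. f (y - x)) = (LINT y|lborel. f y)"
proof -
  have "integrable (distr lborel borel ((+) (- x))) f"
    using f by (simp add: lborel_distr_plus)
  then show "integrable lborel (\<lambda>y. f (y - x))"
    by (subst (asm) integrable_distr_eq) (use f in auto)
  have "(LINT y|lborel. f y) = (LINT y|distr lborel borel ((+) (- x)). f y)"
    by (simp add: lborel_distr_plus)
  also have "\<dots> = (LINT y|lborel. f (y - x))"
    by (subst integral_distr) (use f in auto)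
  finally show "(LINT y|lborel. f (y - x)) = (LINT y|lborel. f y)" ..
qed

text \<open>Fubini with the whole space as second factor: by translation invariance the inner
  integral is the same constant for every \<open>x\<close>, and \<open>D\<close> has finite measure.
  The case of \<open>E\<close> follows by restriction.\<close>

lemma set_integrable_frac_kernel_Times:
  fixes D E :: "'a::euclidean_space set"
  assumes s: "0 < s" "s < 1" and D: "D \<in> sets borel" "bounded D" and E: "E \<in> sets borel"
  shows "set_integrable lborel (D \<times> E) (\<lambda>z. frac_kernel s (fst z - snd z))"
proof -
  note [measurable] = D(1) E
  have ker: "integrable lborel (\<lambda>y. frac_kernel s (x - y))" for x :: 'a
    using integrable_lborel_minus_left[OF integrable_frac_kernel[OF s]]
    by (simp add: frac_kernel_minus[of s x])
  have fin: "emeasure lborel D < \<infinity>" using D(2) by (rule emeasure_bounded_finite)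
  have "integrable (lborel \<Otimes>\<^sub>M lborel) (\<lambda>(x, y). indicator D x * frac_kernel s (x - y))"
  proof (rule lborel_pair.Fubini_integrable)
    show "(\<lambda>(x, y). indicator D x * frac_kernel s (x - y)) \<in> borel_measurable (lborel \<Otimes>\<^sub>M lborel)"
      by measurable
    have "(LINT y|lborel. frac_kernel s (x - y)) = (LINT y|lborel. frac_kernel s (y::'a))" for x :: 'a
      using integral_lborel_minus_left[OF integrable_frac_kernel[OF s], of x]
      by (simp add: frac_kernel_minus[of s x])
    then show "integrable lborel (\<lambda>x. LINT y|lborel. norm (case (x, y) of (x, y) \<Rightarrow> indicator D x * frac_kernel s (x - y)))"
      using fin by (simp add: frac_kernel_nonneg abs_mult)
    show "AE x in lborel. integrable lborel (\<lambda>y. case (x, y) of (x, y) \<Rightarrow> indicator D x * frac_kernel s (x - y))"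
      using ker by simp
  qed
  then have "set_integrable lborel (D \<times> UNIV) (\<lambda>z. frac_kernel s (fst z - snd z))"
    by (simp add: lborel_prod set_integrable_def split_beta' indicator_times)
  then show ?thesis
    by (rule set_integrable_subset) (auto intro!: borel_Times)
qed

section \<open>Stiffness and mass matrices\<close>

lemma c_frac_pos:
  assumes "0 < s" "s < 1"
  shows "0 < c_frac d s"
  unfolding c_frac_def using assms
  by (intro divide_pos_pos mult_pos_pos Gamma_real_pos) auto

lemma frac_dist_nonneg: "0 \<le> frac_dist s x y"
  by (simp add: frac_dist_def)

lemma borel_measurable_frac_dist [measurable]:
  fixes f g :: "'b \<Rightarrow> real^'d"
  assumes [measurable]: "f \<in> borel_measurable M" "g \<in> borel_measurable M"
  shows "(\<lambda>z. frac_dist s (f z) (g z)) \<in> borel_measurable M"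
  unfolding frac_dist_def by measurable

lemma increments_le_frac_kernel:
  fixes x y :: "real^'d"
  assumes "\<bar>a\<bar> \<le> A * min 1 (norm (x - y))" "\<bar>b\<bar> \<le> B * min 1 (norm (x - y))"
  shows "\<bar>a * b * (1 / frac_dist s x y)\<bar> \<le> A * B * frac_kernel s (x - y)"
proof -
  \<comment> \<open>The signs of \<open>A\<close> and \<open>B\<close> are not given; their products
    with the minimum are nonnegative because they bound absolute values.\<close>
  have "\<bar>a\<bar> * \<bar>b\<bar> \<le> (A * min 1 (norm (x - y))) * (B * min 1 (norm (x - y)))"
    using assms by (intro mult_mono order_trans[OF abs_ge_zero assms(1)]) auto
  then have "\<bar>a\<bar> * \<bar>b\<bar> / frac_dist s x y \<le>
      (A * min 1 (norm (x - y))) * (B * min 1 (norm (x - y))) / frac_dist s x y"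
    by (rule divide_right_mono) (rule frac_dist_nonneg)
  then show ?thesis
    using frac_dist_nonneg[of s x y]
    by (simp add: abs_mult frac_kernel_def frac_dist_def power2_eq_square mult_ac)
qed

lemma set_integrable_gagliardo:
  fixes u v :: "real^'d \<Rightarrow> real"
  assumes s: "0 < s" "s < 1" and D: "D \<in> sets borel" "bounded D"
    and u: "u \<in> borel_measurable borel" "\<And>x y. \<bar>u x - u y\<bar> \<le> A * min 1 (norm (x - y))"
    and v: "v \<in> borel_measurable borel" "\<And>x y. \<bar>v x - v y\<bar> \<le> B * min 1 (norm (x - y))"
  shows "set_integrable lborel (D \<times> D)
    (\<lambda>z. (u (fst z) - u (snd z)) * (v (fst z) - v (snd z)) * (1 / frac_dist s (fst z) (snd z)))"
proof (rule set_integrable_bound)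
  show "set_integrable lborel (D \<times> D) (\<lambda>z. A * B * frac_kernel s (fst z - snd z))"
    using set_integrable_frac_kernel_Times[OF s D D(1)] by simp
  note [measurable] = D(1) u(1) v(1)
  have "(\<lambda>z. indicator (D \<times> D) z * ((u (fst z) - u (snd z)) * (v (fst z) - v (snd z)) * (1 / frac_dist s (fst z) (snd z))))
      \<in> borel_measurable (borel \<Otimes>\<^sub>M borel)"
    by measurable
  then show "set_borel_measurable lborel (D \<times> D)
      (\<lambda>z. (u (fst z) - u (snd z)) * (v (fst z) - v (snd z)) * (1 / frac_dist s (fst z) (snd z)))"
    by (simp add: set_borel_measurable_def borel_prod)
  show "AE z in lborel. z \<in> D \<times> D \<longrightarrow>
      norm ((u (fst z) - u (snd z)) * (v (fst z) - v (snd z)) * (1 / frac_dist s (fst z) (snd z)))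
      \<le> norm (A * B * frac_kernel s (fst z - snd z))"
    using order_trans[OF increments_le_frac_kernel[OF u(2) v(2)] abs_ge_self] by simp
qed

text \<open>Since \<open>u\<close> and \<open>v\<close> vanish off \<open>D\<close>, their values in \<open>D\<close> are increments across the boundary;
  this compensates the blow-up of the weight there.\<close>
lemma set_integrable_killing:
  fixes u v :: "real^'d \<Rightarrow> real"
  assumes s: "0 < s" "s < 1" and D: "D \<in> sets borel" "bounded D"
    and u: "u \<in> borel_measurable borel" "\<And>x y. \<bar>u x - u y\<bar> \<le> A * min 1 (norm (x - y))"
      "\<And>x. x \<notin> D \<Longrightarrow> u x = 0"
    and v: "v \<in> borel_measurable borel" "\<And>x y. \<bar>v x - v y\<bar> \<le> B * min 1 (norm (x - y))"
      "\<And>x. x \<notin> D \<Longrightarrow> v x = 0"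
  shows "set_integrable lborel D (\<lambda>x. u x * v x * (LINT y:-D|lborel. 1 / frac_dist s x y))"
proof (rule set_integrable_bound)
  note [measurable] = D(1) u(1) v(1)
  define I where "I = (LINT y|lborel. frac_kernel s (y :: real^'d))"
  show "set_integrable lborel D (\<lambda>x. A * B * I)"
    using emeasure_bounded_finite[OF D(2)] by (auto simp: set_integrable_def)
  have "(\<lambda>x. LINT y|lborel. indicator (- D) y * (1 / frac_dist s x y)) \<in> borel_measurable lborel"
    by measurable
  then show "set_borel_measurable lborel D (\<lambda>x. u x * v x * (LINT y:-D|lborel. 1 / frac_dist s x y))"
    unfolding set_borel_measurable_def set_lebesgue_integral_def by simp
  have ker: "integrable lborel (\<lambda>y. frac_kernel s (x - y))"
    and ker_eq: "(LINT y|lborel. frac_kernel s (x - y)) = I" for x :: "real^'d"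
    using integrable_lborel_minus_left[OF integrable_frac_kernel[OF s], of x]
      integral_lborel_minus_left[OF integrable_frac_kernel[OF s], of x]
    by (simp_all add: frac_kernel_minus[of s x] I_def)
  have "\<bar>u x * v x * (LINT y:-D|lborel. 1 / frac_dist s x y)\<bar> \<le> A * B * I" for x
  proof -
    let ?f = "\<lambda>y. indicator (- D) y * (u x * v x * (1 / frac_dist s x y))"
    have bound: "\<bar>?f y\<bar> \<le> A * B * frac_kernel s (x - y)" for y
    proof (cases "y \<in> D")
      case True
      have "0 \<le> A * B * frac_kernel s (x - y)"
        using increments_le_frac_kernel[OF u(2)[of x y] v(2)[of x y], of s] by linarith
      then show ?thesis using True by simp
    next
      case False
      then show ?thesis
        using increments_le_frac_kernel[OF u(2)[of x y] v(2)[of x y], of s] u(3) v(3) by simp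
    qed
    have g: "integrable lborel (\<lambda>y. A * B * frac_kernel s (x - y))"
      using ker by simp
    have f: "integrable lborel ?f"
    proof (rule Bochner_Integration.integrable_bound[OF g])
      show "?f \<in> borel_measurable lborel" by measurable
      show "AE y in lborel. norm (?f y) \<le> norm (A * B * frac_kernel s (x - y))"
        using order_trans[OF bound abs_ge_self] by simp
    qed
    \<comment> \<open>Valid even if the weight diverges at \<open>x\<close>: a nonzero factor
      preserves and reflects integrability, and a zero factor makes both sides 0.\<close>
    have "u x * v x * (LINT y:-D|lborel. 1 / frac_dist s x y) =
        (LINT y|lborel. u x * v x * (indicator (- D) y * (1 / frac_dist s x y)))"
      by (simp only: integral_mult_right_zero set_lebesgue_integral_def real_scaleR_def)
    also have "\<dots> = (LINT y|lborel. ?f y)" by (simp only: mult_ac)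
    finally have "\<bar>u x * v x * (LINT y:-D|lborel. 1 / frac_dist s x y)\<bar> = norm (LINT y|lborel. ?f y)"
      by simp
    also have "\<dots> \<le> (LINT y|lborel. A * B * frac_kernel s (x - y))"
      using bound by (intro Bochner_Integration.integral_norm_bound_integral f g) auto
    also have "\<dots> = A * B * I" by (simp add: ker_eq)
    finally show ?thesis .
  qed
  then show "AE x in lborel. x \<in> D \<longrightarrow>
      norm (u x * v x * (LINT y:-D|lborel. 1 / frac_dist s x y)) \<le> norm (A * B * I)"
    by (auto intro!: order_trans[OF _ abs_ge_self])
qed

text \<open>Both parts of the form are Gram forms with nonnegative weights: \<open>G1\<close> of the
  increments on pairs of points, \<open>G2\<close> of the values against the exterior
  weight.\<close>

lemma a_form_quadratic_nonneg:
  fixes \<phi> :: "nat \<Rightarrow> real^'d \<Rightarrow> real"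
  assumes s: "0 < s" "s < 1" and D: "D \<in> sets borel" "bounded D"
    and lip: "\<And>i. i < n \<Longrightarrow> (L i)-lipschitz_on UNIV (\<phi> i)"
    and supp: "\<And>i x. i < n \<Longrightarrow> x \<notin> D \<Longrightarrow> \<phi> i x = 0"
  shows "0 \<le> (\<Sum>i<n. \<Sum>j<n. c i * c j * a_form s D (\<phi> i) (\<phi> j))"
proof -
  define d where "d i z = \<phi> i (fst z) - \<phi> i (snd z)" for i and z :: "(real^'d) \<times> (real^'d)"
  define \<kappa> where "\<kappa> x = (LINT y:-D|lborel. 1 / frac_dist s x y)" for x
  have \<kappa>0: "0 \<le> \<kappa> x" for x
    unfolding \<kappa>_def set_lebesgue_integral_def
    by (intro Bochner_Integration.integral_nonneg) (simp add: frac_dist_nonneg)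
  have meas: "\<phi> i \<in> borel_measurable borel" if "i < n" for i
    using lipschitz_on_continuous_on[OF lip[OF that]] by (rule borel_measurable_continuous_onI)
  have inc: "\<exists>C. \<forall>x y. \<bar>\<phi> i x - \<phi> i y\<bar> \<le> C * min 1 (norm (x - y))" if "i < n" for i
    using lipschitz_bounded_support[OF lip[OF that] supp[OF that] D(2)] by blast
  have int1: "set_integrable lborel (D \<times> D) (\<lambda>z. d i z * d j z * (1 / frac_dist s (fst z) (snd z)))"
    if ij: "i < n" "j < n" for i j
    using inc[OF ij(1)] inc[OF ij(2)] unfolding d_def
    by (elim exE) (rule set_integrable_gagliardo[OF s D meas[OF ij(1)] _ meas[OF ij(2)]], blast+)
  have int2: "set_integrable lborel D (\<lambda>x. \<phi> i x * \<phi> j x * \<kappa> x)" if ij: "i < n" "j < n" for i j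
    using inc[OF ij(1)] inc[OF ij(2)] unfolding \<kappa>_def
    by (elim exE) (rule set_integrable_killing[OF s D meas[OF ij(1)] _ supp[OF ij(1)] meas[OF ij(2)] _ supp[OF ij(2)]], blast+)
  define G1 where "G1 i j = (LINT z:D \<times> D|lborel. d i z * d j z * (1 / frac_dist s (fst z) (snd z)))" for i j
  define G2 where "G2 i j = (LINT x:D|lborel. \<phi> i x * \<phi> j x * \<kappa> x)" for i j
  have "0 \<le> (\<Sum>i<n. \<Sum>j<n. c i * c j * G1 i j)"
    unfolding G1_def using int1 by (rule gram_quadratic_form_nonneg) (simp_all add: frac_dist_nonneg)
  moreover have "0 \<le> (\<Sum>i<n. \<Sum>j<n. c i * c j * G2 i j)"
    unfolding G2_def using int2 \<kappa>0 by (rule gram_quadratic_form_nonneg)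
  moreover have "(\<Sum>i<n. \<Sum>j<n. c i * c j * a_form s D (\<phi> i) (\<phi> j)) =
      c_frac CARD('d) s / 2 * (\<Sum>i<n. \<Sum>j<n. c i * c j * G1 i j) +
      c_frac CARD('d) s * (\<Sum>i<n. \<Sum>j<n. c i * c j * G2 i j)"
  proof -
    have a: "a_form s D (\<phi> i) (\<phi> j) = c_frac CARD('d) s / 2 * G1 i j + c_frac CARD('d) s * G2 i j" for i j
      by (simp add: a_form_def G1_def G2_def d_def \<kappa>_def)
    have "c i * c j * a_form s D (\<phi> i) (\<phi> j) =
        c_frac CARD('d) s / 2 * (c i * c j * G1 i j) + c_frac CARD('d) s * (c i * c j * G2 i j)" for i j
      unfolding a by (simp add: algebra_simps)
    then show ?thesis by (simp only: sum.distrib sum_distrib_left)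
  qed
  ultimately show ?thesis using c_frac_pos[OF s, of "CARD('d)"] by simp
qed

lemma mass_quadratic_pos:
  fixes \<phi> :: "nat \<Rightarrow> 'a::euclidean_space \<Rightarrow> real"
  assumes D: "open D" and cont: "\<And>i. i < n \<Longrightarrow> continuous_on UNIV (\<phi> i)"
    and int: "\<And>i j. i < n \<Longrightarrow> j < n \<Longrightarrow> set_integrable lborel D (\<lambda>x. \<phi> i x * \<phi> j x)"
    and z: "z \<in> D" "(\<Sum>i<n. c i * \<phi> i z) \<noteq> 0"
  shows "0 < (\<Sum>i<n. \<Sum>j<n. c i * c j * (LINT x:D|lborel. \<phi> i x * \<phi> j x))"
proof -
  define w where "w x = (\<Sum>i<n. c i * \<phi> i x)" for x
  have w_cont: "continuous_on UNIV w"
    unfolding w_def using cont by (intro continuous_intros) auto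
  have int_w: "integrable lborel (\<lambda>x. indicator D x * (w x)\<^sup>2)"
    and eq: "(\<Sum>i<n. \<Sum>j<n. c i * c j * (LINT x:D|lborel. \<phi> i x * \<phi> j x)) =
      (LINT x|lborel. indicator D x * (w x)\<^sup>2)"
    using gram_quadratic_form[where k = "\<lambda>_. 1" and F = \<phi> and M = lborel and A = D and n = n and c = c] int
    by (simp_all add: w_def set_integrable_def set_lebesgue_integral_def)
  have nonneg: "0 \<le> (LINT x|lborel. indicator D x * (w x)\<^sup>2)"
    by (intro Bochner_Integration.integral_nonneg) simp
  have "(LINT x|lborel. indicator D x * (w x)\<^sup>2) \<noteq> 0"
  proof
    assume "(LINT x|lborel. indicator D x * (w x)\<^sup>2) = 0"
    then have ae: "AE x in lborel. indicator D x * (w x)\<^sup>2 = 0"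
      using int_w by (subst (asm) integral_nonneg_eq_0_iff_AE) auto
    \<comment> \<open>The set where the combination is nonzero is open and contains
      \<open>z\<close>. A vanishing integral would make it negligible, which a nonempty open set is
      not.\<close>
    define U where "U = D \<inter> w -` (- {0})"
    have U: "open U" "z \<in> U"
      using D w_cont z open_vimage[of "- {0}" w] by (auto simp: U_def w_def)
    have "AE x in lborel. x \<notin> U"
      using ae by eventually_elim (auto simp: U_def indicator_def split: if_splits)
    then have "U \<in> null_sets lborel"
      using U(1) by (subst AE_iff_null_sets) auto
    then have "negligible U"
      by (simp add: negligible_iff_null_sets null_sets_completionI)
    then show False using U open_not_negligible by blast
  qed
  then show ?thesis using nonneg eq by linarith
qed

lemma quadratic_form_mass_matrix:
  assumes "v \<in> carrier_vec n"
  shows "v \<bullet> (mass_matrix D n \<phi> *\<^sub>v v) =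
    (\<Sum>i<n. \<Sum>j<n. vec_index v i * vec_index v j * (LINT x:D|lborel. \<phi> i x * \<phi> j x))"
  unfolding mass_matrix_def by (subst quadratic_form_mat[OF assms]) simp

lemma transpose_mass_matrix: "transpose_mat (mass_matrix D n \<phi>) = mass_matrix D n \<phi>"
  by (rule eq_matI) (auto simp: mass_matrix_def mult.commute)

lemma transpose_stiffness_matrix: "transpose_mat (stiffness_matrix s D n \<phi>) = stiffness_matrix s D n \<phi>"
  by (rule eq_matI) (auto simp: stiffness_matrix_def a_form_def mult.commute)

text \<open>Continuity is asked on the closure because the observation basis, extended by zero, may
  jump across the boundary of its domain; compactness of the closure then gives
  integrability.\<close>

lemma set_integrable_mult_bounded_open:
  fixes u v :: "'a::euclidean_space \<Rightarrow> real"
  assumes "open D" "bounded D" "continuous_on (closure D) u" "continuous_on (closure D) v"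
  shows "set_integrable lborel D (\<lambda>x. u x * v x)"
proof (rule set_integrable_subset[of _ "closure D"])
  show "set_integrable lborel (closure D) (\<lambda>x. u x * v x)"
    unfolding set_integrable_def using assms
    by (intro borel_integrable_compact continuous_intros) (simp_all)
qed (use assms closure_subset in auto)

lemma mass_matrix_nonneg:
  assumes D: "open D" "bounded D" and \<phi>: "\<And>i. i < n \<Longrightarrow> continuous_on (closure D) (\<phi> i)"
    and v: "v \<in> carrier_vec n"
  shows "0 \<le> v \<bullet> (mass_matrix D n \<phi> *\<^sub>v v)"
  using gram_quadratic_form_nonneg[where k = "\<lambda>_. 1" and F = \<phi> and M = lborel and A = D and n = n]
    set_integrable_mult_bounded_open[OF D \<phi> \<phi>]
  by (simp add: quadratic_form_mass_matrix[OF v])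

lemma sym_pos_def_stiffness_plus_mass:
  fixes \<phi> :: "nat \<Rightarrow> real^'d \<Rightarrow> real"
  assumes s: "0 < s" "s < 1" and D: "open D" "bounded D"
    and lip: "\<And>i. i < n \<Longrightarrow> (L i)-lipschitz_on UNIV (\<phi> i)"
    and supp: "\<And>i x. i < n \<Longrightarrow> x \<notin> D \<Longrightarrow> \<phi> i x = 0"
    and dual: "\<And>i j. i < n \<Longrightarrow> j < n \<Longrightarrow> \<phi> i (z j) = (if i = j then 1 else 0)"
    and z: "\<And>i. i < n \<Longrightarrow> z i \<in> D"
  shows "sym_pos_def n (stiffness_matrix s D n \<phi> + mass_matrix D n \<phi>)"
  unfolding sym_pos_def_def
proof (intro conjI ballI impI)
  let ?A = "stiffness_matrix s D n \<phi>" and ?M = "mass_matrix D n \<phi>"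
  have c: "?A \<in> carrier_mat n n" "?M \<in> carrier_mat n n"
    by (simp_all add: stiffness_matrix_def mass_matrix_def)
  then show "?A + ?M \<in> carrier_mat n n" by simp
  show "transpose_mat (?A + ?M) = ?A + ?M"
    using transpose_add[OF c] by (simp add: transpose_stiffness_matrix transpose_mass_matrix)
  fix v :: "real vec" assume v: "v \<in> carrier_vec n" "v \<noteq> 0\<^sub>v n"
  then obtain k where k: "k < n" "vec_index v k \<noteq> 0"
    by (metis carrier_vecD eq_vecI index_zero_vec)
  have cont: "continuous_on A (\<phi> i)" if "i < n" for i A
    using lipschitz_on_continuous_on[OF lip[OF that]] continuous_on_subset by blast
  \<comment> \<open>By duality the combination takes the value of the nonzero coefficient
    \<open>k\<close> at the node \<open>z k\<close>.\<close>
  have "(\<Sum>i<n. vec_index v i * \<phi> i (z k)) = (\<Sum>i<n. if i = k then vec_index v k else 0)"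
    by (intro sum.cong) (auto simp: dual k(1))
  then have "(\<Sum>i<n. vec_index v i * \<phi> i (z k)) \<noteq> 0" using k by simp
  then have "0 < v \<bullet> (?M *\<^sub>v v)"
    unfolding quadratic_form_mass_matrix[OF v(1)]
    by (intro mass_quadratic_pos[OF D(1), of n \<phi> "z k"] set_integrable_mult_bounded_open[OF D] cont z k(1))
  moreover have "0 \<le> v \<bullet> (?A *\<^sub>v v)"
    unfolding stiffness_matrix_def quadratic_form_mat[OF v(1)] prod.case
    using D by (intro a_form_quadratic_nonneg[OF s _ _ lip supp]) auto
  moreover have "v \<bullet> ((?A + ?M) *\<^sub>v v) = v \<bullet> (?A *\<^sub>v v) + v \<bullet> (?M *\<^sub>v v)"
    using c v(1) by (simp add: add_mult_distrib_mat_vec[where nr = n and nc = n]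
        scalar_prod_add_distrib[where n = n])
  ultimately show "0 < v \<bullet> ((?A + ?M) *\<^sub>v v)" by linarith
qed

theorem theorem3p5:
  fixes s R d\<^sub>0 h \<gamma> \<gamma>\<^sub>W \<alpha> :: real
    and \<Omega> W :: "(real^'d) set"
    and T T\<^sub>W :: "(real^'d) set set"
    and p q N\<^sub>0 N\<^sub>W :: nat
    and \<phi> \<theta> :: "nat \<Rightarrow> real^'d \<Rightarrow> real"
    and z x :: "nat \<Rightarrow> real^'d"
    and f g u\<^sub>f :: "real^'d \<Rightarrow> real"
    and B Wm A\<^sub>0 M\<^sub>0 S :: "real mat" and \<mu> :: "real vec"
  assumes "0 < s" "s < 1"
    and "lipschitz_polyhedral_domain \<Omega>"
    and "open W" "bounded W" "W \<noteq> {}"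
    and "closure W \<subseteq> - closure \<Omega>"
    and "setdist W \<Omega> = d\<^sub>0" "0 < d\<^sub>0"
    and "\<Omega> \<union> W \<subseteq> cube R"
    \<comment> \<open>interior discretization\<close>
    and "mesh T (cube R)" "quasi_uniform \<gamma> T" "mesh_size T = h" "fitted T \<Omega>"
    and "1 \<le> p"
    and "nodal_basis (fe_space0 p T (cube R) \<Omega>) (lagrange_nodes p T \<inter> \<Omega>) N\<^sub>0 z \<phi>"
    \<comment> \<open>observation space\<close>
    and "mesh T\<^sub>W W" "shape_regular \<gamma>\<^sub>W T\<^sub>W"
    and "1 \<le> q"
    and "nodal_basis (fe_space q T\<^sub>W W) (lagrange_nodes q T\<^sub>W) N\<^sub>W x \<theta>"
    \<comment> \<open>matrices\<close>
    and "B = observation_matrix s \<Omega> N\<^sub>W x N\<^sub>0 \<phi>"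
    and "Wm = mass_matrix W N\<^sub>W \<theta>"
    and "A\<^sub>0 = stiffness_matrix s (cube R) N\<^sub>0 \<phi>"
    and "M\<^sub>0 = mass_matrix (cube R) N\<^sub>0 \<phi>"
    and "S = A\<^sub>0 + M\<^sub>0"
    \<comment> \<open>data; the noisy measurement \<open>g\<close> is an arbitrary function\<close>
    and "test_function W f"
    and "nodal_interpolant (fe_space p T (cube R)) (lagrange_nodes p T) f u\<^sub>f"
    and "\<mu> = data_vector s (cube R) N\<^sub>W x g u\<^sub>f"
    and "0 < \<alpha>"
  shows "(\<exists>!v. is_arg_min (tikhonov B Wm S \<mu> \<alpha>) (\<lambda>w. w \<in> carrier_vec N\<^sub>0) v) \<and>
    sym_pos_def N\<^sub>0 (transpose_mat B * Wm * B + \<alpha> \<cdot>\<^sub>m S) \<and>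
    (\<exists>!v. v \<in> carrier_vec N\<^sub>0 \<and>
       (transpose_mat B * Wm * B + \<alpha> \<cdot>\<^sub>m S) *\<^sub>v v = transpose_mat B *\<^sub>v (Wm *\<^sub>v \<mu>)) \<and>
    (\<forall>v. is_arg_min (tikhonov B Wm S \<mu> \<alpha>) (\<lambda>w. w \<in> carrier_vec N\<^sub>0) v \<longrightarrow>
       (transpose_mat B * Wm * B + \<alpha> \<cdot>\<^sub>m S) *\<^sub>v v = transpose_mat B *\<^sub>v (Wm *\<^sub>v \<mu>))"
proof -
  have "open \<Omega>" "bounded \<Omega>" and \<Omega>D: "\<Omega> \<subseteq> cube R"
    using \<open>lipschitz_polyhedral_domain \<Omega>\<close> \<open>\<Omega> \<union> W \<subseteq> cube R\<close>
    by (simp_all add: lipschitz_polyhedral_domain_def)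
  have D: "open (cube R :: (real^'d) set)" "bounded (cube R :: (real^'d) set)"
    by (simp_all add: cube_def open_box)
  note nb = \<open>nodal_basis (fe_space0 p T (cube R) \<Omega>) (lagrange_nodes p T \<inter> \<Omega>) N\<^sub>0 z \<phi>\<close>
  have \<phi>: "\<phi> i \<in> fe_space0 p T (cube R) \<Omega>" if "i < N\<^sub>0" for i
    using nb that by (simp add: nodal_basis_def)
  have dual: "\<phi> i (z j) = (if i = j then 1 else 0)" if "i < N\<^sub>0" "j < N\<^sub>0" for i j
    using nb that by (simp add: nodal_basis_def)
  have "bij_betw z {..<N\<^sub>0} (lagrange_nodes p T \<inter> \<Omega>)"
    using nb by (simp add: nodal_basis_def)
  then have z: "z i \<in> cube R" if "i < N\<^sub>0" for i
    using bij_betwE that \<Omega>D by blast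
  have supp: "\<phi> i y = 0" if "i < N\<^sub>0" "y \<notin> cube R" for i y
    using \<phi>[OF that(1)] that(2) \<Omega>D by (auto simp: fe_space0_def)
  have "\<forall>i\<in>{..<N\<^sub>0}. \<exists>L. L-lipschitz_on UNIV (\<phi> i)"
    using fe_space0_lipschitz[OF \<phi> \<open>mesh T (cube R)\<close> D(1) \<Omega>D] by simp
  from bchoice[OF this] obtain L where lip: "\<And>i. i < N\<^sub>0 \<Longrightarrow> (L i)-lipschitz_on UNIV (\<phi> i)"
    by auto
  have S: "sym_pos_def N\<^sub>0 S"
    unfolding \<open>S = A\<^sub>0 + M\<^sub>0\<close> \<open>A\<^sub>0 = _\<close> \<open>M\<^sub>0 = _\<close>
    using \<open>0 < s\<close> \<open>s < 1\<close> D lip supp dual z by (rule sym_pos_def_stiffness_plus_mass)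
  have \<theta>: "continuous_on (closure W) (\<theta> k)" if "k < N\<^sub>W" for k
    using \<open>nodal_basis (fe_space q T\<^sub>W W) _ _ _ _\<close> that by (simp add: nodal_basis_def fe_space_def)
  have Wm: "Wm \<in> carrier_mat N\<^sub>W N\<^sub>W" "transpose_mat Wm = Wm"
    "\<And>y. y \<in> carrier_vec N\<^sub>W \<Longrightarrow> 0 \<le> y \<bullet> (Wm *\<^sub>v y)"
    unfolding \<open>Wm = _\<close>
    using transpose_mass_matrix mass_matrix_nonneg[OF \<open>open W\<close> \<open>bounded W\<close> \<theta>]
    by (simp_all add: mass_matrix_def)
  have B: "B \<in> carrier_mat N\<^sub>W N\<^sub>0"
    unfolding \<open>B = _\<close> by (simp add: observation_matrix_def)
  have \<mu>: "\<mu> \<in> carrier_vec N\<^sub>W"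
    unfolding \<open>\<mu> = _\<close> by (simp add: data_vector_def)
  have spd: "sym_pos_def N\<^sub>0 (transpose_mat B * Wm * B + \<alpha> \<cdot>\<^sub>m S)"
    using B Wm S \<open>0 < \<alpha>\<close> by (rule sym_pos_def_normal_matrix)
  have "transpose_mat B *\<^sub>v (Wm *\<^sub>v \<mu>) \<in> carrier_vec N\<^sub>0"
    using B Wm(1) \<mu> by auto
  note ex1 = sym_pos_def_ex1_solution[OF spd this]
  have iff: "v \<in> carrier_vec N\<^sub>0 \<and>
      (transpose_mat B * Wm * B + \<alpha> \<cdot>\<^sub>m S) *\<^sub>v v = transpose_mat B *\<^sub>v (Wm *\<^sub>v \<mu>) \<longleftrightarrow>
    is_arg_min (tikhonov B Wm S \<mu> \<alpha>) (\<lambda>w. w \<in> carrier_vec N\<^sub>0) v" for v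
    using B Wm S \<mu> \<open>0 < \<alpha>\<close> by (rule tikhonov_minimizer)
  \<comment> \<open>Solutions and minimizers form the same set, so unique solvability of the system
    is uniqueness of the minimizer.\<close>
  have "\<exists>!v. is_arg_min (tikhonov B Wm S \<mu> \<alpha>) (\<lambda>w. w \<in> carrier_vec N\<^sub>0) v"
    using ex1 by (simp only: iff)
  then show ?thesis
    using spd ex1 iff by blast
qed

end
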